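(* Let $\Psi$ be any invariant of even virtual links. Then for a virtual link $L$ with multi-core decomposition $L=C_1\cup\dots\cup C_n\cup M_n$, $\Psi$ induces a tuple of invariants $(\Psi(C_1),\ldots,\Psi(C_n))$, and the tuple itself is an invariant of $L$.
   Context: Virtual links are equivalence classes of virtual link diagrams (with classical and virtual crossings) under classical and virtual Reidemeister moves. For a diagram of $L=K_1\cup\dots\cup K_\ell$, a mixed crossing is a classical crossing between different components; $\pi(K_i)$ is the number of mixed crossings involving $K_i$ modulo 2. A component is odd if $\pi(K_i)=1$ and even otherwise; a link is even if all its components are even (the empty link is even), and odd otherwise. Core: delete all odd components of $L$ to get $L_1$; if $L_1$ is not even, delete all components that are odd in $L_1$ (regarded as a link by itself) to get $L_2$, and so on, until an even (possibly empty) sub-link is obtained; this is the core of $L$. The mantle is the complement of the core in $L$. Multi-core decomposition: let $C_1$ be the core of $L$ and $M_1$ its mantle; let $C_2$ be the core of $M_1$ and $M_2$ the mantle of $M_1$; and so on, until $M_n$ is either empty or has an empty core. This gives $L=C_1\cup\dots\cup C_n\cup M_n$. *)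

theory Defs
  imports "HOL-Analysis.Analysis"
begin

section \<open>Virtual link diagrams\<close>

text \<open>
  Diagrams are polygonal: a component is a closed polygon in the plane (type \<^typ>\<open>complex\<close>),
  given by the list of its vertices in cyclic order, and an edge is a segment regarded as a set of
  points. In a diagram two edges have at most one crossing, so a crossing is named by its two
  edges. \<open>over\<close> holds the over/under information: \<open>(e, f)\<close> in \<open>over\<close> means that the crossing of
  \<open>e\<close> and \<open>f\<close> is classical and \<open>e\<close> passes over \<open>f\<close>. A crossing about which \<open>over\<close> says nothing
  is virtual.
\<close>

record vdiagram =
  comps :: "complex list set"
  over :: "(complex set \<times> complex set) set"

definition poly_edges :: "complex list \<Rightarrow> complex set set" where
  "poly_edges P = set (map2 closed_segment P (rotate1 P))"

definition edges :: "vdiagram \<Rightarrow> complex set set" where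
  "edges D = (\<Union>P\<in>comps D. poly_edges P)"

definition verts :: "vdiagram \<Rightarrow> complex set" where
  "verts D = (\<Union>P\<in>comps D. set P)"

definition crossing :: "vdiagram \<Rightarrow> complex set \<Rightarrow> complex set \<Rightarrow> bool" where
  "crossing D e f \<longleftrightarrow>
     e \<in> edges D \<and> f \<in> edges D \<and> e \<noteq> f \<and> e \<inter> f \<noteq> {} \<and> e \<inter> f \<inter> verts D = {}"

definition classical_crossing :: "vdiagram \<Rightarrow> complex set \<Rightarrow> complex set \<Rightarrow> bool" where
  "classical_crossing D e f \<longleftrightarrow> crossing D e f \<and> ((e, f) \<in> over D \<or> (f, e) \<in> over D)"

definition virtual_crossing :: "vdiagram \<Rightarrow> complex set \<Rightarrow> complex set \<Rightarrow> bool" where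
  "virtual_crossing D e f \<longleftrightarrow> crossing D e f \<and> (e, f) \<notin> over D \<and> (f, e) \<notin> over D"

text \<open>
  General position: a vertex lies only on the two edges that end in it, and no point lies on three
  edges. The first condition rules out overlapping collinear edges, so any two edges meet either
  in a common vertex or transversally in one point interior to both.
\<close>

definition is_vdiagram :: "vdiagram \<Rightarrow> bool" where
  "is_vdiagram D \<longleftrightarrow>
     finite (comps D) \<and>
     (\<forall>P\<in>comps D. 3 \<le> length P \<and> distinct P) \<and>
     (\<forall>P\<in>comps D. \<forall>Q\<in>comps D. P \<noteq> Q \<longrightarrow> set P \<inter> set Q = {}) \<and>
     (\<forall>v\<in>verts D. \<forall>a b. closed_segment a b \<in> edges D \<and> v \<in> closed_segment a b \<longrightarrow> v = a \<or> v = b) \<and>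
     (\<forall>e\<in>edges D. \<forall>f\<in>edges D. \<forall>g\<in>edges D. e \<noteq> f \<and> f \<noteq> g \<and> e \<noteq> g \<longrightarrow> e \<inter> f \<inter> g = {}) \<and>
     (\<forall>e f. (e, f) \<in> over D \<longrightarrow> crossing D e f \<and> (f, e) \<notin> over D)"


section \<open>Reidemeister moves and virtual links\<close>

definition same_type ::
  "vdiagram \<Rightarrow> complex set \<Rightarrow> complex set \<Rightarrow> vdiagram \<Rightarrow> complex set \<Rightarrow> complex set \<Rightarrow> bool" where
  "same_type D e f D' e' f' \<longleftrightarrow>
     ((e, f) \<in> over D \<longleftrightarrow> (e', f') \<in> over D') \<and> ((f, e) \<in> over D \<longleftrightarrow> (f', e') \<in> over D')"

text \<open>
  \<open>D'\<close> arises from \<open>D\<close> by replacing the edge from \<open>a\<close> to \<open>b\<close> by the polygonal path through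
  \<open>a\<close>, \<open>cs\<close>, \<open>b\<close>; nothing else changes. The edge may be taken to be the first one of its polygon,
  as \<open>vmove\<close> below allows the starting vertex of a polygon to be changed.
\<close>

definition replaces_edge ::
  "vdiagram \<Rightarrow> vdiagram \<Rightarrow> complex \<Rightarrow> complex list \<Rightarrow> complex \<Rightarrow> bool" where
  "replaces_edge D D' a cs b \<longleftrightarrow>
     is_vdiagram D \<and> is_vdiagram D' \<and>
     (\<exists>xs R. a # b # xs \<notin> R \<and>
        comps D = insert (a # b # xs) R \<and> comps D' = insert (a # cs @ b # xs) R) \<and>
     (let F = edges D - {closed_segment a b} in over D \<inter> F \<times> F = over D' \<inter> F \<times> F)"

definition avoids :: "complex set \<Rightarrow> complex \<Rightarrow> complex \<Rightarrow> complex list \<Rightarrow> bool" where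
  "avoids f a b cs \<longleftrightarrow> f \<inter> convex hull ({a, b} \<union> set cs) \<subseteq> {a, b}"

text \<open>
  The edge \<open>f\<close> enters the triangle \<open>a, b, c\<close> through the side \<open>[a, b]\<close> and leaves it through
  exactly one of the other two sides; the crossing keeps its type when \<open>[a, b]\<close> is replaced by
  these two sides.
\<close>

definition passes_through ::
  "vdiagram \<Rightarrow> vdiagram \<Rightarrow> complex \<Rightarrow> complex \<Rightarrow> complex \<Rightarrow> complex set \<Rightarrow> bool" where
  "passes_through D D' a c b f \<longleftrightarrow>
     crossing D (closed_segment a b) f \<and>
     (crossing D' (closed_segment a c) f \<noteq> crossing D' (closed_segment c b) f) \<and>
     (\<forall>e'\<in>{closed_segment a c, closed_segment c b}.
        crossing D' e' f \<longrightarrow> same_type D (closed_segment a b) f D' e' f)"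

text \<open>
  Three pairwise crossing strands admit a third Reidemeister move if one of them crosses both
  others virtually (the purely virtual move and the mixed move with one classical crossing), or if
  all three crossings are classical and the strands are stacked in layers. The forbidden moves,
  with exactly one virtual crossing, are excluded.
\<close>

definition r3_admissible ::
  "vdiagram \<Rightarrow> complex set \<Rightarrow> complex set \<Rightarrow> complex set \<Rightarrow> bool" where
  "r3_admissible D e f g \<longleftrightarrow>
     (\<exists>x y z. {x, y, z} = {e, f, g} \<and>
        (virtual_crossing D x y \<and> virtual_crossing D x z \<and> crossing D y z \<or>
         (x, y) \<in> over D \<and> (x, z) \<in> over D \<and> (y, z) \<in> over D))"

datatype orientation = Oriented | Unoriented

text \<open>
  \<open>restart\<close> and \<open>reverse\<close> only change the list that describes a polygon. The other moves replace
  an edge by a path. \<open>isotopy\<close> is planar isotopy: the edge sweeps a triangle that other strands at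
  most cross side by side. It includes the subdivision of an edge, where the triangle is
  degenerate. In \<open>R1\<close>, \<open>R2\<close> and \<open>R3\<close> the crossing types are arbitrary up to the stated
  conditions, so each covers the classical and the virtual versions of the move, and \<open>R3\<close> also the
  mixed one. In \<open>R1\<close> the path \<open>a, c, d, b\<close> runs along both diagonals of a convex quadrilateral
  with sides \<open>[a, b]\<close> and \<open>[c, d]\<close>.
\<close>

inductive vmove :: "orientation \<Rightarrow> vdiagram \<Rightarrow> vdiagram \<Rightarrow> bool" for ori where
  restart:
    "\<lbrakk>is_vdiagram D; comps D = insert P R; P \<notin> R\<rbrakk>
     \<Longrightarrow> vmove ori D (D\<lparr>comps := insert (rotate1 P) R\<rparr>)"
| reverse:
    "\<lbrakk>ori = Unoriented; is_vdiagram D; comps D = insert P R; P \<notin> R\<rbrakk>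
     \<Longrightarrow> vmove ori D (D\<lparr>comps := insert (rev P) R\<rparr>)"
| isotopy:
    "\<lbrakk>replaces_edge D D' a [c] b;
      \<forall>f\<in>edges D - {closed_segment a b}. avoids f a b [c] \<or> passes_through D D' a c b f;
      \<forall>f g. passes_through D D' a c b f \<and> passes_through D D' a c b g \<and> f \<noteq> g
        \<longrightarrow> f \<inter> g \<inter> convex hull {a, b, c} = {}\<rbrakk>
     \<Longrightarrow> vmove ori D D'"
| R1:
    "\<lbrakk>replaces_edge D D' a [c, d] b;
      \<forall>f\<in>edges D - {closed_segment a b}. avoids f a b [c, d];
      crossing D' (closed_segment a c) (closed_segment d b)\<rbrakk>
     \<Longrightarrow> vmove ori D D'"
| R2:
    "\<lbrakk>replaces_edge D D' a [c] b;
      f \<in> edges D; f \<inter> closed_segment a b = {};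
      crossing D' (closed_segment a c) f; crossing D' (closed_segment c b) f;
      same_type D' (closed_segment a c) f D' (closed_segment c b) f;
      \<forall>g\<in>edges D - {closed_segment a b, f}. avoids g a b [c]\<rbrakk>
     \<Longrightarrow> vmove ori D D'"
| R3:
    "\<lbrakk>replaces_edge D D' a [c] b;
      passes_through D D' a c b f; passes_through D D' a c b g; f \<noteq> g;
      f \<inter> g \<inter> convex hull {a, b, c} \<noteq> {};
      r3_admissible D (closed_segment a b) f g;
      \<forall>h\<in>edges D - {closed_segment a b, f, g}. avoids h a b [c]\<rbrakk>
     \<Longrightarrow> vmove ori D D'"

text \<open>Two diagrams represent the same virtual link iff they are related by \<open>same_link\<close>.\<close>

definition same_link :: "orientation \<Rightarrow> vdiagram \<Rightarrow> vdiagram \<Rightarrow> bool" where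
  "same_link ori = equivclp (vmove ori)"


section \<open>Parity, core and multi-core decomposition\<close>

definition mixed_crossings :: "vdiagram \<Rightarrow> complex list \<Rightarrow> (complex set \<times> complex set) set" where
  "mixed_crossings D P =
     {(e, f). e \<in> poly_edges P \<and> (\<exists>Q\<in>comps D - {P}. f \<in> poly_edges Q) \<and> classical_crossing D e f}"

definition parity :: "vdiagram \<Rightarrow> complex list \<Rightarrow> nat" where
  "parity D P = card (mixed_crossings D P) mod 2"

definition odd_comps :: "vdiagram \<Rightarrow> complex list set" where
  "odd_comps D = {P \<in> comps D. parity D P = 1}"

definition even_link :: "vdiagram \<Rightarrow> bool" where
  "even_link D \<longleftrightarrow> odd_comps D = {}"

definition sublink :: "vdiagram \<Rightarrow> complex list set \<Rightarrow> vdiagram" where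
  "sublink D S =
     (let E = \<Union>P\<in>S. poly_edges P in \<lparr>comps = S, over = over D \<inter> E \<times> E\<rparr>)"

definition delete_odd :: "vdiagram \<Rightarrow> vdiagram" where
  "delete_odd D = sublink D (comps D - odd_comps D)"

definition core :: "vdiagram \<Rightarrow> vdiagram" where
  "core D = (delete_odd ^^ (LEAST k. even_link ((delete_odd ^^ k) D))) D"

definition mantle :: "vdiagram \<Rightarrow> vdiagram" where
  "mantle D = sublink D (comps D - comps (core D))"

text \<open>
  The number \<open>n\<close> of cores; \<open>C\<^sub>1\<close> is always formed, so \<open>n \<ge> 1\<close>. The \<open>k\<close>-th iterated mantle
  \<open>M\<^sub>k\<close> is \<open>(mantle ^^ k) D\<close>, with \<open>M\<^sub>0 = D\<close>.
\<close>

definition num_cores :: "vdiagram \<Rightarrow> nat" where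
  "num_cores D =
     (LEAST n. 1 \<le> n \<and> (comps ((mantle ^^ n) D) = {} \<or> comps (core ((mantle ^^ n) D)) = {}))"

definition multi_core :: "vdiagram \<Rightarrow> vdiagram list" where
  "multi_core D = map (\<lambda>k. core ((mantle ^^ k) D)) [0..<num_cores D]"

definition link_invariant :: "orientation \<Rightarrow> (vdiagram \<Rightarrow> 'a) \<Rightarrow> bool" where
  "link_invariant ori \<Phi> \<longleftrightarrow>
     (\<forall>D D'. is_vdiagram D \<and> is_vdiagram D' \<and> same_link ori D D' \<longrightarrow> \<Phi> D = \<Phi> D')"

definition even_link_invariant :: "orientation \<Rightarrow> (vdiagram \<Rightarrow> 'a) \<Rightarrow> bool" where
  "even_link_invariant ori \<Psi> \<longleftrightarrow>
     (\<forall>D D'. is_vdiagram D \<and> is_vdiagram D' \<and> even_link D \<and> even_link D' \<and> same_link ori D D'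
        \<longrightarrow> \<Psi> D = \<Psi> D')"


section \<open>The constructions terminate\<close>

lemma comps_sublink [simp]: "comps (sublink D S) = S"
  by (simp add: sublink_def Let_def)

lemma is_vdiagram_sublink:
  assumes D: "is_vdiagram D" and S: "S \<subseteq> comps D"
  shows "is_vdiagram (sublink D S)"
proof -
  let ?D = "sublink D S"
  have E: "e \<in> edges D" if "e \<in> edges ?D" for e
    using S that by (auto simp: edges_def)
  have V: "verts ?D \<subseteq> verts D"
    using S by (auto simp: verts_def)
  have ov: "(e, f) \<in> over ?D \<longleftrightarrow> (e, f) \<in> over D \<and> e \<in> edges ?D \<and> f \<in> edges ?D" for e f
    by (simp add: sublink_def Let_def edges_def)
  have fin: "finite (comps D)"
    and len: "\<And>P. P \<in> comps D \<Longrightarrow> 3 \<le> length P \<and> distinct P"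
    and dis: "\<And>P Q. P \<in> comps D \<Longrightarrow> Q \<in> comps D \<Longrightarrow> P \<noteq> Q \<Longrightarrow> set P \<inter> set Q = {}"
    and gen: "\<And>v a b. v \<in> verts D \<Longrightarrow> closed_segment a b \<in> edges D \<Longrightarrow> v \<in> closed_segment a b
        \<Longrightarrow> v = a \<or> v = b"
    and trip: "\<And>e f g. e \<in> edges D \<Longrightarrow> f \<in> edges D \<Longrightarrow> g \<in> edges D \<Longrightarrow> e \<noteq> f \<Longrightarrow> f \<noteq> g \<Longrightarrow> e \<noteq> g
        \<Longrightarrow> e \<inter> f \<inter> g = {}"
    and over: "\<And>e f. (e, f) \<in> over D \<Longrightarrow> crossing D e f \<and> (f, e) \<notin> over D"
    using D unfolding is_vdiagram_def by simp_all
  have over': "crossing ?D e f \<and> (f, e) \<notin> over ?D" if "(e, f) \<in> over ?D" for e f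
  proof -
    have "(e, f) \<in> over D" and ef: "e \<in> edges ?D" "f \<in> edges ?D"
      using that ov by simp_all
    then have cr: "crossing D e f" and "(f, e) \<notin> over D" using over by simp_all
    moreover have "e \<inter> f \<inter> verts ?D = {}"
      using cr V unfolding crossing_def by auto
    ultimately show ?thesis using ef ov by (simp add: crossing_def)
  qed
  show ?thesis
    unfolding is_vdiagram_def comps_sublink
  proof (intro conjI ballI allI impI)
    show "finite S" using fin S finite_subset by auto
  next
    fix P assume "P \<in> S"
    then show "3 \<le> length P" "distinct P" using len S by auto
  next
    fix P Q assume "P \<in> S" "Q \<in> S" "P \<noteq> Q"
    then show "set P \<inter> set Q = {}" using dis S by auto
  next
    fix v a b assume "v \<in> verts ?D" "closed_segment a b \<in> edges ?D \<and> v \<in> closed_segment a b"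
    then show "v = a \<or> v = b" using gen[of v a b] E V by auto
  next
    fix e f g assume "e \<in> edges ?D" "f \<in> edges ?D" "g \<in> edges ?D" "e \<noteq> f \<and> f \<noteq> g \<and> e \<noteq> g"
    then show "e \<inter> f \<inter> g = {}" using trip E by simp
  next
    fix e f assume "(e, f) \<in> over ?D"
    then show "crossing ?D e f" "(f, e) \<notin> over ?D" using over' by simp_all
  qed
qed

lemma comps_delete_odd_pow: "comps ((delete_odd ^^ k) D) \<subseteq> comps D"
  by (induction k) (auto simp: delete_odd_def)

lemma ex_even_delete_odd_pow:
  assumes "finite (comps D)"
  shows "\<exists>k. even_link ((delete_odd ^^ k) D)"
  using assms
proof (induction "card (comps D)" arbitrary: D rule: less_induct)
  case less
  show ?case
  proof (cases "even_link D")
    case True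
    then show ?thesis by (intro exI[of _ 0]) simp
  next
    case False
    then have "comps (delete_odd D) \<subset> comps D"
      by (auto simp: delete_odd_def even_link_def odd_comps_def)
    then have "card (comps (delete_odd D)) < card (comps D)" "finite (comps (delete_odd D))"
      using less.prems by (auto intro: psubset_card_mono finite_subset)
    then obtain k where "even_link ((delete_odd ^^ k) (delete_odd D))"
      using less.hyps by blast
    then show ?thesis by (intro exI[of _ "Suc k"]) (simp add: funpow_swap1)
  qed
qed

lemma even_link_core:
  assumes "is_vdiagram D"
  shows "even_link (core D)"
  unfolding core_def
  by (rule LeastI_ex, rule ex_even_delete_odd_pow) (use assms in \<open>simp add: is_vdiagram_def\<close>)

lemma comps_core: "comps (core D) \<subseteq> comps D"
  by (simp add: core_def comps_delete_odd_pow)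

lemma comps_mantle_pow: "comps ((mantle ^^ k) D) \<subseteq> comps D"
  by (induction k) (auto simp: mantle_def)

lemma num_cores:
  assumes "is_vdiagram D"
  defines "M \<equiv> (mantle ^^ num_cores D) D"
  shows "1 \<le> num_cores D \<and> (comps M = {} \<or> comps (core M) = {})"
proof -
  let ?Q = "\<lambda>n. 1 \<le> n \<and> (comps ((mantle ^^ n) D) = {} \<or> comps (core ((mantle ^^ n) D)) = {})"
  have fin: "finite (comps ((mantle ^^ n) D))" for n
    using assms(1) finite_subset[OF comps_mantle_pow] by (simp add: is_vdiagram_def)
  have "\<exists>n. ?Q n"
  proof (rule ccontr)
    assume no: "\<not> (\<exists>n. ?Q n)"
    have "card (comps ((mantle ^^ Suc (Suc n)) D)) < card (comps ((mantle ^^ Suc n) D))" for n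
    proof (rule psubset_card_mono[OF fin])
      have "comps (core ((mantle ^^ Suc n) D)) \<noteq> {}"
        using no by (metis One_nat_def Suc_le_mono zero_le)
      then show "comps ((mantle ^^ Suc (Suc n)) D) \<subset> comps ((mantle ^^ Suc n) D)"
        using comps_core[of "(mantle ^^ Suc n) D"]
        unfolding funpow.simps(2)[of "Suc n"] o_apply
        by (subst mantle_def) auto
    qed
    then have "\<exists>f. \<forall>n. (f (Suc n), f n) \<in> {(x::nat, y). x < y}"
      by (intro exI[of _ "\<lambda>n. card (comps ((mantle ^^ Suc n) D))"]) simp
    then show False
      using wf_iff_no_infinite_down_chain wf_less by blast
  qed
  then have "?Q (num_cores D)" unfolding num_cores_def by (rule LeastI_ex)
  then show ?thesis by (simp add: M_def)
qed

lemma multi_core_decomposition: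
  "comps D = (\<Union>C\<in>set (multi_core D). comps C) \<union> comps ((mantle ^^ num_cores D) D)"
proof -
  have "comps D = (\<Union>k<n. comps (core ((mantle ^^ k) D))) \<union> comps ((mantle ^^ n) D)" for n
  proof (induction n)
    case (Suc n)
    have "comps ((mantle ^^ n) D)
        = comps (core ((mantle ^^ n) D)) \<union> comps ((mantle ^^ Suc n) D)"
      using comps_core[of "(mantle ^^ n) D"]
      by (auto simp: mantle_def[of "(mantle ^^ n) D"])
    then show ?case using Suc by (auto simp: lessThan_Suc)
  qed simp
  then show ?thesis by (simp add: multi_core_def lessThan_atLeast0)
qed

end

theory Submission
  imports Defs
begin

text \<open>
  A move that replaces an edge of a component acts on every sub-link containing that component as
  a move, possibly of another kind, and leaves every other sub-link unchanged. It also preserves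
  the parity of each component in each sub-link: the number of classical crossings of the replaced
  path with any other edge changes only by an even number. So equivalent diagrams have a bijection
  between their components under which corresponding sub-links represent the same virtual link and
  corresponding components have equal parity. Since core and mantle are built from parities of
  sub-links alone, the bijection carries the decomposition of one diagram to that of the other.
\<close>

section \<open>Edges of polygons\<close>

text \<open>An open path, unlike the closed \<open>poly_edges\<close>, can be cut at a vertex. This
  separates a replaced edge from the rest of its polygon.\<close>

fun path_edges :: "complex list \<Rightarrow> complex set set" where
  "path_edges (p # q # ps) = insert (closed_segment p q) (path_edges (q # ps))"
| "path_edges _ = {}"

lemma path_edges_append:
  "path_edges (us @ v # ws) = path_edges (us @ [v]) \<union> path_edges (v # ws)"
  by (induction us rule: path_edges.induct) simp_all

lemma path_edges_rev: "path_edges (rev ps) = path_edges ps"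
proof (induction ps rule: path_edges.induct)
  case (1 p q ps)
  have "path_edges (rev (p # q # ps)) = path_edges (rev ps @ [q]) \<union> path_edges [q, p]"
    using path_edges_append[of "rev ps" q "[p]"] by simp
  then show ?case using 1 by (auto simp: closed_segment_commute)
qed auto

lemma path_edges_endpoints:
  "e \<in> path_edges ps \<Longrightarrow> \<exists>u\<in>set ps. \<exists>v\<in>set ps. e = closed_segment u v"
  by (induction ps rule: path_edges.induct) auto

text \<open>The last vertex \<open>b\<close> is excluded as the named end \<open>u\<close>. Applied
  to a new path, this exhibits an inserted vertex as an end of each edge.\<close>

lemma path_edges_inner_endpoint:
  "e \<in> path_edges (c # cs @ [b]) \<Longrightarrow> \<exists>u\<in>set (c # cs). \<exists>v. e = closed_segment u v"
proof (induction cs arbitrary: c)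
  case (Cons x xs)
  then show ?case by (cases "e = closed_segment c x") auto
qed auto

lemma finite_path_edges: "finite (path_edges ps)"
  by (induction ps rule: path_edges.induct) auto

lemma poly_edges_Cons: "poly_edges (p # ps) = path_edges (p # ps @ [p])"
proof -
  have "set (map2 closed_segment (p # ps) (ps @ [q])) = path_edges (p # ps @ [q])" for q
    by (induction ps arbitrary: p) auto
  then show ?thesis by (simp add: poly_edges_def)
qed

lemma poly_edges_rotate1: "poly_edges (rotate1 P) = poly_edges P"
proof (cases P)
  case (Cons p ps)
  show ?thesis
  proof (cases ps)
    case (Cons q qs)
    have "poly_edges (q # qs @ [p]) = path_edges (q # qs @ [p]) \<union> path_edges [p, q]"
      using path_edges_append[of "q # qs" p "[q]"] poly_edges_Cons[of q "qs @ [p]"] by simp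
    then show ?thesis using \<open>P = p # ps\<close> Cons by (auto simp: poly_edges_Cons)
  qed (simp add: \<open>P = p # ps\<close>)
qed simp

lemma poly_edges_rev: "poly_edges (rev P) = poly_edges P"
proof (cases P)
  case (Cons p ps)
  \<comment> \<open>\<open>rev P\<close> is one rotation of \<open>p # rev ps\<close>, and the
    latter closes up to the reversal of the closed path of \<open>P\<close>.\<close>
  have "poly_edges (rev P) = poly_edges (p # rev ps)"
    using poly_edges_rotate1[of "p # rev ps"] Cons by simp
  also have "\<dots> = path_edges (rev (p # ps @ [p]))" by (simp add: poly_edges_Cons)
  also have "\<dots> = poly_edges P" by (simp only: path_edges_rev) (simp add: Cons poly_edges_Cons)
  finally show ?thesis .
qed simp

lemma finite_poly_edges: "finite (poly_edges P)"
  by (simp add: poly_edges_def)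

lemma poly_edges_endpoints:
  "e \<in> poly_edges P \<Longrightarrow> \<exists>u\<in>set P. \<exists>v\<in>set P. e = closed_segment u v"
  by (fastforce simp: poly_edges_def dest: set_zip_leftD set_zip_rightD)


section \<open>Crossings\<close>

lemma edges_endpoints:
  "e \<in> edges D \<Longrightarrow> \<exists>u\<in>verts D. \<exists>v\<in>verts D. e = closed_segment u v"
  unfolding edges_def verts_def by (blast dest: poly_edges_endpoints)

text \<open>General position turns a vertex lying on both edges into a common end. What remains
  refers only to the two segments and their ends, so crossings become comparable across
  diagrams.\<close>

lemma crossing_closed_segment_iff:
  assumes D: "is_vdiagram D"
    and e: "closed_segment p q \<in> edges D" and f: "closed_segment r s \<in> edges D"
  shows "crossing D (closed_segment p q) (closed_segment r s) \<longleftrightarrow>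
    closed_segment p q \<noteq> closed_segment r s \<and>
    closed_segment p q \<inter> closed_segment r s \<noteq> {} \<and> {p, q} \<inter> {r, s} = {}"
proof -
  \<comment> \<open>A segment determines its unordered pair of ends, so \<open>p\<close> and
    \<open>q\<close> are the vertices supplied by \<open>edges_endpoints\<close>.\<close>
  have V: "p \<in> verts D" "q \<in> verts D"
    using edges_endpoints[OF e] by (auto simp: doubleton_eq_iff)
  have gen: "v \<in> {a, b}"
    if "v \<in> verts D" "closed_segment a b \<in> edges D" "v \<in> closed_segment a b" for v a b
    using D that by (simp add: is_vdiagram_def)
  have "closed_segment p q \<inter> closed_segment r s \<inter> verts D = {p, q} \<inter> {r, s}"
    (is "?L = ?R")
  proof
    show "?L \<subseteq> ?R" using gen[OF _ e] gen[OF _ f] by blast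
    show "?R \<subseteq> ?L" using V by auto
  qed
  then show ?thesis using e f by (simp add: crossing_def)
qed

text \<open>By general position, a vertex on both edges is an end of both, whatever else the diagram contains.\<close>

lemma crossing_cong:
  assumes "is_vdiagram D" "is_vdiagram D'"
    and "e \<in> edges D" "f \<in> edges D" "e \<in> edges D'" "f \<in> edges D'"
  shows "crossing D e f \<longleftrightarrow> crossing D' e f"
  using edges_endpoints[OF assms(3)] edges_endpoints[OF assms(4)] assms
  by (auto simp: crossing_closed_segment_iff)

lemma crossing_commute: "crossing D e f \<longleftrightarrow> crossing D f e"
  by (auto simp: crossing_def)

lemma classical_crossing_commute: "classical_crossing D e f \<longleftrightarrow> classical_crossing D f e"
  by (auto simp: classical_crossing_def crossing_commute)

lemma edges_sublink: "edges (sublink D S) = (\<Union>P\<in>S. poly_edges P)"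
  by (simp add: edges_def)

lemma edges_sublink_subset: "S \<subseteq> comps D \<Longrightarrow> edges (sublink D S) \<subseteq> edges D"
  by (auto simp: edges_def)

lemma over_sublink:
  "(e, f) \<in> over (sublink D S) \<longleftrightarrow>
    (e, f) \<in> over D \<and> e \<in> edges (sublink D S) \<and> f \<in> edges (sublink D S)"
  by (simp add: sublink_def Let_def edges_def)

lemma crossing_sublink:
  assumes "is_vdiagram D" "S \<subseteq> comps D"
  shows "crossing (sublink D S) e f \<longleftrightarrow>
    crossing D e f \<and> e \<in> edges (sublink D S) \<and> f \<in> edges (sublink D S)"
  using crossing_cong[OF is_vdiagram_sublink[OF assms] assms(1), of e f]
    edges_sublink_subset[OF assms(2)]
  by (auto simp: crossing_def)

lemma classical_crossing_sublink:
  assumes "is_vdiagram D" "S \<subseteq> comps D"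
  shows "classical_crossing (sublink D S) e f \<longleftrightarrow>
    classical_crossing D e f \<and> e \<in> edges (sublink D S) \<and> f \<in> edges (sublink D S)"
  by (auto simp: classical_crossing_def crossing_sublink[OF assms] over_sublink)

lemma sublink_sublink: "T \<subseteq> S \<Longrightarrow> sublink (sublink D S) T = sublink D T"
  by (auto simp: sublink_def Let_def)

lemma sublink_comps:
  assumes "is_vdiagram D"
  shows "sublink D (comps D) = D"
proof -
  have "over D \<subseteq> edges D \<times> edges D"
    using assms by (auto simp: is_vdiagram_def crossing_def)
  then show ?thesis by (simp add: sublink_def edges_def Let_def inf.absorb1)
qed

definition crossing_number :: "vdiagram \<Rightarrow> complex set set \<Rightarrow> complex set set \<Rightarrow> nat" where
  "crossing_number D A B = card {(e, f). e \<in> A \<and> f \<in> B \<and> classical_crossing D e f}"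

lemma crossing_number_commute: "crossing_number D A B = crossing_number D B A"
proof -
  have "{(e, f). e \<in> A \<and> f \<in> B \<and> classical_crossing D e f}
      = {(e, f). e \<in> B \<and> f \<in> A \<and> classical_crossing D e f}\<inverse>"
    by (auto simp: classical_crossing_commute)
  then show ?thesis by (simp add: crossing_number_def)
qed

text \<open>Counting over the edges of \<open>B\<close> allows two crossing numbers to be compared
  modulo 2 one strand \<open>f\<close> at a time.\<close>

lemma crossing_number_sum:
  assumes "finite A" "finite B"
  shows "crossing_number D A B = (\<Sum>f\<in>B. card {e \<in> A. classical_crossing D e f})"
proof -
  have "{(f, e). f \<in> B \<and> e \<in> A \<and> classical_crossing D f e}
      = (SIGMA f:B. {e \<in> A. classical_crossing D f e})" by auto
  then have "crossing_number D B A = (\<Sum>f\<in>B. card {e \<in> A. classical_crossing D f e})"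
    using assms by (simp add: crossing_number_def)
  then show ?thesis
    by (simp add: crossing_number_commute[of D A] classical_crossing_commute)
qed

text \<open>The classical crossings of a sub-link are those of \<open>D\<close> between its own
  edges, so the parities in all sub-links can be computed in the one diagram
  \<open>D\<close>.\<close>

lemma parity_sublink:
  assumes "is_vdiagram D" "S \<subseteq> comps D" "P \<in> S"
  shows "parity (sublink D S) P
    = crossing_number D (poly_edges P) (\<Union>Q\<in>S - {P}. poly_edges Q) mod 2"
proof -
  have "mixed_crossings (sublink D S) P = {(e, f). e \<in> poly_edges P \<and>
      f \<in> (\<Union>Q\<in>S - {P}. poly_edges Q) \<and> classical_crossing D e f}"
    using assms(3)
    by (auto simp: mixed_crossings_def classical_crossing_sublink[OF assms(1,2)] edges_sublink)
  then show ?thesis by (simp add: parity_def crossing_number_def)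
qed


section \<open>Component-wise equivalence of diagrams\<close>

text \<open>All sub-links are quantified over because the core deletes components repeatedly, and
  oddness is judged anew in each remaining sub-link. Parity is a separate clause because
  \<open>same_link\<close> does not record which component corresponds to which.\<close>

definition link_iso ::
  "orientation \<Rightarrow> (complex list \<Rightarrow> complex list) \<Rightarrow> vdiagram \<Rightarrow> vdiagram \<Rightarrow> bool" where
  "link_iso ori \<phi> D D' \<longleftrightarrow> bij_betw \<phi> (comps D) (comps D') \<and>
     (\<forall>S\<subseteq>comps D. same_link ori (sublink D S) (sublink D' (\<phi> ` S)) \<and>
        (\<forall>P\<in>S. parity (sublink D S) P = parity (sublink D' (\<phi> ` S)) (\<phi> P)))"

lemma same_link_refl: "same_link ori D D"
  by (simp add: same_link_def)

lemma same_link_sym: "same_link ori D D' \<Longrightarrow> same_link ori D' D"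
  unfolding same_link_def by (rule equivclp_sym)

lemma same_link_trans: "same_link ori D D' \<Longrightarrow> same_link ori D' D'' \<Longrightarrow> same_link ori D D''"
  unfolding same_link_def by (rule equivclp_trans)

lemma link_iso_refl: "link_iso ori id D D"
  by (simp add: link_iso_def same_link_refl)

lemma link_iso_sym:
  assumes "link_iso ori \<phi> D D'"
  shows "link_iso ori (inv_into (comps D) \<phi>) D' D"
  unfolding link_iso_def
proof (intro conjI allI impI ballI)
  let ?\<psi> = "inv_into (comps D) \<phi>"
  have b: "bij_betw \<phi> (comps D) (comps D')" using assms by (simp add: link_iso_def)
  then show "bij_betw ?\<psi> (comps D') (comps D)" by (rule bij_betw_inv_into)
  fix S assume S: "S \<subseteq> comps D'"
  have sub: "?\<psi> ` S \<subseteq> comps D"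
    using bij_betw_inv_into[OF b] S by (auto simp: bij_betw_def)
  have im: "\<phi> ` ?\<psi> ` S = S"
    using b S by (auto simp: bij_betw_def image_image f_inv_into_f subset_iff)
  show "same_link ori (sublink D' S) (sublink D (?\<psi> ` S))"
    using assms sub im unfolding link_iso_def by (metis same_link_sym)
  fix P assume P: "P \<in> S"
  have "\<phi> (?\<psi> P) = P" using b S P by (auto simp: bij_betw_def f_inv_into_f)
  then show "parity (sublink D' S) P = parity (sublink D (?\<psi> ` S)) (?\<psi> P)"
    using assms sub im P unfolding link_iso_def by (metis imageI)
qed

lemma link_iso_trans:
  assumes 1: "link_iso ori \<phi> D D'" and 2: "link_iso ori \<psi> D' D''"
  shows "link_iso ori (\<psi> \<circ> \<phi>) D D''"
  unfolding link_iso_def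
proof (intro conjI allI impI ballI)
  show "bij_betw (\<psi> \<circ> \<phi>) (comps D) (comps D'')"
    using 1 2 by (auto simp: link_iso_def intro: bij_betw_trans)
  fix S assume S: "S \<subseteq> comps D"
  then have S': "\<phi> ` S \<subseteq> comps D'" using 1 by (auto simp: link_iso_def bij_betw_def)
  have im: "(\<psi> \<circ> \<phi>) ` S = \<psi> ` \<phi> ` S" by (simp add: image_comp)
  show "same_link ori (sublink D S) (sublink D'' ((\<psi> \<circ> \<phi>) ` S))"
    using 1 2 S S' unfolding im link_iso_def by (meson same_link_trans)
  fix P assume "P \<in> S"
  then show "parity (sublink D S) P = parity (sublink D'' ((\<psi> \<circ> \<phi>) ` S)) ((\<psi> \<circ> \<phi>) P)"
    using 1 2 S S' unfolding im link_iso_def by simp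
qed

text \<open>A sub-link of a sub-link is a sub-link of the whole diagram, so the same
  \<open>\<phi>\<close> serves after any deletion.\<close>

lemma link_iso_sublink:
  assumes "link_iso ori \<phi> D D'" "S \<subseteq> comps D"
  shows "link_iso ori \<phi> (sublink D S) (sublink D' (\<phi> ` S))"
proof -
  have "bij_betw \<phi> S (\<phi> ` S)"
    using assms unfolding link_iso_def by (meson bij_betw_subset)
  moreover have "sublink (sublink D S) T = sublink D T"
    "sublink (sublink D' (\<phi> ` S)) (\<phi> ` T) = sublink D' (\<phi> ` T)" if "T \<subseteq> S" for T
    using that by (simp_all add: sublink_sublink image_mono)
  ultimately show ?thesis
    using assms by (simp add: link_iso_def)
qed

lemma link_iso_comps: "link_iso ori \<phi> D D' \<Longrightarrow> comps D' = \<phi> ` comps D"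
  by (simp add: link_iso_def bij_betw_def)

lemma image_Diff_link_iso:
  "link_iso ori \<phi> D D' \<Longrightarrow> S \<subseteq> comps D \<Longrightarrow> \<phi> ` (comps D - S) = comps D' - \<phi> ` S"
  by (auto simp: link_iso_def bij_betw_def inj_on_image_set_diff[of _ "comps D"])

lemma odd_comps_subset: "odd_comps D \<subseteq> comps D"
  by (auto simp: odd_comps_def)

section \<open>Transport of parity, core, mantle and multi-core decomposition\<close>

context
  fixes ori \<phi> D D'
  assumes iso: "link_iso ori \<phi> D D'" and D: "is_vdiagram D" and D': "is_vdiagram D'"
begin

lemma link_iso_same_link: "same_link ori D D'"
  and link_iso_parity: "P \<in> comps D \<Longrightarrow> parity D P = parity D' (\<phi> P)"
proof -
  \<comment> \<open>The case of the full sub-link, which is the diagram itself.\<close>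
  have "same_link ori (sublink D (comps D)) (sublink D' (\<phi> ` comps D)) \<and>
      (\<forall>P\<in>comps D. parity (sublink D (comps D)) P = parity (sublink D' (\<phi> ` comps D)) (\<phi> P))"
    using iso by (simp add: link_iso_def)
  then show "same_link ori D D'" "P \<in> comps D \<Longrightarrow> parity D P = parity D' (\<phi> P)"
    unfolding link_iso_comps[OF iso, symmetric] sublink_comps[OF D] sublink_comps[OF D']
    by blast+
qed

lemma link_iso_odd_comps: "odd_comps D' = \<phi> ` odd_comps D"
  by (auto simp: odd_comps_def link_iso_comps[OF iso] link_iso_parity)

lemma link_iso_even_link: "even_link D' \<longleftrightarrow> even_link D"
  by (simp add: even_link_def link_iso_odd_comps)

lemma link_iso_delete_odd: "link_iso ori \<phi> (delete_odd D) (delete_odd D')"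
proof -
  have "\<phi> ` (comps D - odd_comps D) = comps D' - odd_comps D'"
    using image_Diff_link_iso[OF iso odd_comps_subset] by (simp only: link_iso_odd_comps)
  then show ?thesis
    using link_iso_sublink[OF iso Diff_subset, of "odd_comps D"] by (simp only: delete_odd_def)
qed

end

lemma is_vdiagram_delete_odd_pow: "is_vdiagram D \<Longrightarrow> is_vdiagram ((delete_odd ^^ k) D)"
  by (induction k) (simp_all add: delete_odd_def is_vdiagram_sublink)

lemma is_vdiagram_core: "is_vdiagram D \<Longrightarrow> is_vdiagram (core D)"
  by (simp add: core_def is_vdiagram_delete_odd_pow)

lemma is_vdiagram_mantle_pow: "is_vdiagram D \<Longrightarrow> is_vdiagram ((mantle ^^ k) D)"
  by (induction k) (simp_all add: mantle_def is_vdiagram_sublink)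

lemma link_iso_core:
  assumes iso: "link_iso ori \<phi> D D'" and D: "is_vdiagram D" and D': "is_vdiagram D'"
  shows "link_iso ori \<phi> (core D) (core D')"
proof -
  have pow: "link_iso ori \<phi> ((delete_odd ^^ k) D) ((delete_odd ^^ k) D')" for k
  proof (induction k)
    case (Suc k)
    show ?case
      using link_iso_delete_odd[OF Suc is_vdiagram_delete_odd_pow[OF D] is_vdiagram_delete_odd_pow[OF D']]
      by simp
  qed (simp add: iso)
  \<comment> \<open>Both deletion sequences become even at the same stages, so the least stages in
    the definition of \<open>core\<close> agree.\<close>
  then have "even_link ((delete_odd ^^ k) D') \<longleftrightarrow> even_link ((delete_odd ^^ k) D)" for k
    by (rule link_iso_even_link[OF _ is_vdiagram_delete_odd_pow[OF D] is_vdiagram_delete_odd_pow[OF D']])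
  then show ?thesis using pow by (simp add: core_def)
qed

lemma link_iso_mantle:
  assumes iso: "link_iso ori \<phi> D D'" and D: "is_vdiagram D" and D': "is_vdiagram D'"
  shows "link_iso ori \<phi> (mantle D) (mantle D')"
proof -
  have "\<phi> ` (comps D - comps (core D)) = comps D' - comps (core D')"
    unfolding link_iso_comps[OF link_iso_core[OF assms]]
    by (rule image_Diff_link_iso[OF iso comps_core])
  then show ?thesis
    using link_iso_sublink[OF iso Diff_subset, of "comps (core D)"] by (simp only: mantle_def)
qed

lemma link_iso_multi_core:
  assumes iso: "link_iso ori \<phi> D D'" and D: "is_vdiagram D" and D': "is_vdiagram D'"
  shows "list_all2 (same_link ori) (multi_core D) (multi_core D')"
proof -
  have pow: "link_iso ori \<phi> ((mantle ^^ k) D) ((mantle ^^ k) D')" for k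
  proof (induction k)
    case (Suc k)
    show ?case
      using link_iso_mantle[OF Suc is_vdiagram_mantle_pow[OF D] is_vdiagram_mantle_pow[OF D']]
      by simp
  qed (simp add: iso)
  then have core: "link_iso ori \<phi> (core ((mantle ^^ k) D)) (core ((mantle ^^ k) D'))" for k
    by (rule link_iso_core[OF _ is_vdiagram_mantle_pow[OF D] is_vdiagram_mantle_pow[OF D']])
  \<comment> \<open>\<open>\<phi>\<close> maps the components of each mantle and each core onto
    those of its counterpart. Emptiness therefore occurs at the same indices, and the two tuples
    have equal length.\<close>
  have "num_cores D' = num_cores D"
    by (simp add: num_cores_def link_iso_comps[OF pow] link_iso_comps[OF core])
  moreover have "same_link ori (core ((mantle ^^ k) D)) (core ((mantle ^^ k) D'))" for k
    by (rule link_iso_same_link[OF core])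
      (rule is_vdiagram_core[OF is_vdiagram_mantle_pow], rule D D')+
  ultimately show ?thesis by (simp add: multi_core_def list_all2_conv_all_nth)
qed

section \<open>Moves\<close>

lemma vdiagram_polygon:
  assumes "is_vdiagram D" "P \<in> comps D"
  shows "3 \<le> length P" "distinct P"
  using assms by (auto simp: is_vdiagram_def)

lemma vdiagram_polygons_disjoint:
  assumes "is_vdiagram D" "P \<in> comps D" "Q \<in> comps D" "P \<noteq> Q"
  shows "set P \<inter> set Q = {}"
  using assms by (auto simp: is_vdiagram_def)

lemma edges_endpoint_in_verts: "closed_segment u v \<in> edges D \<Longrightarrow> u \<in> verts D"
  using edges_endpoints by (fastforce simp: doubleton_eq_iff)

lemma polygon_endpoint: "closed_segment u v \<in> poly_edges P \<Longrightarrow> u \<in> set P"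
  using poly_edges_endpoints by (fastforce simp: doubleton_eq_iff)

section \<open>Moves that only relabel a polygon\<close>

definition replace :: "'b \<Rightarrow> 'b \<Rightarrow> 'b \<Rightarrow> 'b" where
  "replace p p' q = (if q = p then p' else q)"

lemma bij_betw_replace:
  assumes "p \<notin> R" "p' \<notin> R"
  shows "bij_betw (replace p p') (insert p R) (insert p' R)"
  using assms by (auto simp: bij_betw_def inj_on_def replace_def image_def)

lemma replace_image: "p \<notin> S \<Longrightarrow> replace p p' ` S = S"
  by (auto simp: replace_def image_def)

lemma replace_image_insert: "p \<notin> S \<Longrightarrow> replace p p' ` insert p S = insert p' S"
  by (auto simp: replace_def image_def)

text \<open>Treats \<open>restart\<close> and \<open>reverse\<close> together. Relabelling keeps the
  vertex set and edge set of every component, hence all crossings; only the list naming one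
  component changes.\<close>

lemma link_iso_relabel:
  assumes D: "is_vdiagram D" and comps: "comps D = insert P R" "P \<notin> R"
    and P': "set P' = set P" "poly_edges P' = poly_edges P"
    and vm: "\<And>S. S \<subseteq> R \<Longrightarrow>
      vmove ori (sublink D (insert P S)) (sublink D (insert P S)\<lparr>comps := insert P' S\<rparr>)"
  shows "link_iso ori (replace P P') D (D\<lparr>comps := insert P' R\<rparr>)"
  unfolding link_iso_def
proof (intro conjI allI impI ballI)
  let ?\<phi> = "replace P P'" and ?D' = "D\<lparr>comps := insert P' R\<rparr>"
  \<comment> \<open>A polygon in \<open>R\<close> shares no vertex with \<open>P\<close>, whereas
    \<open>P'\<close> has the same nonempty vertex set as \<open>P\<close>.\<close>
  have "P' \<notin> R"
  proof
    assume "P' \<in> R"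
    then have "set P = {}"
      using vdiagram_polygons_disjoint[OF D, of P P'] comps P' by auto
    then show False using vdiagram_polygon(1)[OF D, of P] comps by simp
  qed
  then show bij: "bij_betw ?\<phi> (comps D) (comps ?D')"
    using bij_betw_replace comps by simp
  fix S assume S: "S \<subseteq> comps D"
  have poly: "poly_edges (?\<phi> Q) = poly_edges Q" and set: "set (?\<phi> Q) = set Q" for Q
    using P' by (auto simp: replace_def)
  have sub: "sublink ?D' (?\<phi> ` S) = sublink D S\<lparr>comps := ?\<phi> ` S\<rparr>"
    by (simp add: sublink_def Let_def poly)
  show "same_link ori (sublink D S) (sublink ?D' (?\<phi> ` S))"
  proof (cases "P \<in> S")
    case True
    define T where "T = S - {P}"
    have T: "S = insert P T" "P \<notin> T" "T \<subseteq> R" using True S comps by (auto simp: T_def)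
    then show ?thesis
      unfolding sub unfolding T(1) replace_image_insert[OF T(2)]
      using vm[of T] by (simp add: same_link_def r_into_equivclp)
  next
    case False
    then have "sublink D S\<lparr>comps := ?\<phi> ` S\<rparr> = sublink D S"
      by (simp add: replace_image sublink_def Let_def)
    then show ?thesis by (simp add: sub same_link_refl)
  qed
  fix Q assume Q: "Q \<in> S"
  \<comment> \<open>Injectivity ensures that the components other than the image of \<open>Q\<close>
    are exactly the images of the components other than \<open>Q\<close>.\<close>
  have "inj_on ?\<phi> S" using bij S by (auto simp: bij_betw_def intro: inj_on_subset)
  then have "?\<phi> ` S - {?\<phi> Q} = ?\<phi> ` (S - {Q})"
    using Q by (simp add: inj_on_image_set_diff[of _ S])
  then have "mixed_crossings (sublink ?D' (?\<phi> ` S)) (?\<phi> Q) = mixed_crossings (sublink D S) Q"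
    unfolding sub
    by (simp add: mixed_crossings_def classical_crossing_def crossing_def edges_def verts_def
        poly set)
  then show "parity (sublink D S) Q = parity (sublink ?D' (?\<phi> ` S)) (?\<phi> Q)"
    by (simp add: parity_def)
qed

section \<open>Replacing one edge of a polygon by a path\<close>

locale edge_replacement =
  fixes D D' :: vdiagram and a :: complex and cs :: "complex list" and b :: complex
    and xs :: "complex list" and R :: "complex list set"
  assumes D: "is_vdiagram D" and D': "is_vdiagram D'" and cs: "cs \<noteq> []"
    and P_notin: "a # b # xs \<notin> R"
    and comps: "comps D = insert (a # b # xs) R"
    and comps': "comps D' = insert (a # cs @ b # xs) R"
    and over: "over D \<inter> (edges D - {closed_segment a b}) \<times> (edges D - {closed_segment a b}) =
      over D' \<inter> (edges D - {closed_segment a b}) \<times> (edges D - {closed_segment a b})"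

lemma replaces_edgeE:
  assumes "replaces_edge D D' a cs b" "cs \<noteq> []"
  obtains xs R where "edge_replacement D D' a cs b xs R"
  using assms unfolding replaces_edge_def edge_replacement_def Let_def by blast

context edge_replacement
begin

definition P where "P = a # b # xs"
definition P' where "P' = a # cs @ b # xs"
definition old where "old = closed_segment a b"
definition new where "new = path_edges (a # cs @ [b])"
text \<open>For a sub-link consisting of the changed component and \<open>S\<close>, these are the
  edges common to both diagrams; \<open>kept {}\<close> is what remains of the changed polygon
  alone.\<close>

definition kept where "kept S = path_edges (b # xs @ [a]) \<union> (\<Union>Q\<in>S. poly_edges Q)"

lemma P_comps: "P \<in> comps D" "P' \<in> comps D'"
  by (simp_all add: comps comps' P_def P'_def)

lemma replaces_edge: "replaces_edge D D' a cs b"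
  unfolding replaces_edge_def Let_def using D D' P_notin comps comps' over by blast

lemma distinct_P': "distinct P'" and xs: "xs \<noteq> []"
  using vdiagram_polygon[OF D P_comps(1)] vdiagram_polygon[OF D' P_comps(2)] by (auto simp: P_def)

lemma P'_notin: "P' \<notin> R"
proof
  assume "P' \<in> R"
  then have "P' \<in> comps D" "P' \<noteq> P" using comps P_notin by (auto simp: P_def)
  then have "set P \<inter> set P' = {}"
    using vdiagram_polygons_disjoint[OF D P_comps(1), of P'] by simp
  then show False by (simp add: P_def P'_def)
qed

lemma poly_edges_P: "poly_edges P = insert old (kept {})"
  by (simp add: P_def poly_edges_Cons old_def kept_def)

lemma poly_edges_P': "poly_edges P' = new \<union> kept {}"
  using path_edges_append[of "a # cs" b "xs @ [a]"]
  by (simp add: P'_def poly_edges_Cons new_def kept_def)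

lemma kept_empty_Un: "kept {} \<union> (\<Union>Q\<in>S. poly_edges Q) = kept S"
  by (simp add: kept_def)

lemma kept_mono: "S \<subseteq> T \<Longrightarrow> kept S \<subseteq> kept T"
  by (auto simp: kept_def)

lemma edges_insert_P: "(\<Union>Q\<in>insert P S. poly_edges Q) = insert old (kept S)"
  using poly_edges_P kept_empty_Un[of S] by auto

lemma edges_insert_P': "(\<Union>Q\<in>insert P' S. poly_edges Q) = new \<union> kept S"
  using poly_edges_P' kept_empty_Un[of S] by auto

lemma edges_D: "edges D = insert old (kept R)"
  using edges_insert_P[of R] by (simp add: edges_def comps P_def)

lemma edges_D': "edges D' = new \<union> kept R"
  using edges_insert_P'[of R] by (simp add: edges_def comps' P'_def)

text \<open>A polygon has a third vertex \<open>y\<close>. Beyond the edge from \<open>b\<close> to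
  \<open>y\<close> no edge of the remaining path ends in \<open>b\<close>, and that edge itself does
  not end in \<open>a\<close>. Other polygons do not contain \<open>a\<close>.\<close>

lemma old_notin_kept: "old \<notin> kept R"
proof -
  obtain y ys where y: "xs = y # ys" using xs by (cases xs) auto
  have dist: "distinct (a # b # y # ys)"
    using vdiagram_polygon(2)[OF D P_comps(1)] unfolding P_def unfolding y .
  have "old \<notin> path_edges (y # ys @ [a])"
  proof
    assume "old \<in> path_edges (y # ys @ [a])"
    then have "b \<in> set (y # ys @ [a])"
      by (auto dest!: path_edges_endpoints simp: old_def doubleton_eq_iff)
    then show False using dist by auto
  qed
  moreover have "old \<noteq> closed_segment b y"
    using dist by (auto simp: old_def doubleton_eq_iff)
  moreover have "old \<notin> poly_edges Q" if "Q \<in> R" for Q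
  proof
    assume "old \<in> poly_edges Q"
    then have "a \<in> set Q" by (simp add: old_def polygon_endpoint)
    then show False
      using vdiagram_polygons_disjoint[OF D P_comps(1), of Q] that comps P_notin
      by (auto simp: P_def)
  qed
  ultimately show ?thesis unfolding kept_def unfolding y by auto
qed

lemma kept_eq: "kept R = edges D - {closed_segment a b}"
  using edges_D old_notin_kept by (auto simp: old_def)

text \<open>Disjointness of the polygons of \<open>D'\<close> separates the inserted vertices from
  \<open>R\<close>; distinctness of the vertices of \<open>P'\<close> separates them from
  \<open>P\<close>.\<close>

lemma cs_fresh: "set cs \<inter> verts D = {}"
proof -
  have "set cs \<inter> set Q = {}" if "Q \<in> R" for Q
  proof -
    have "set P' \<inter> set Q = {}"
      using vdiagram_polygons_disjoint[OF D' P_comps(2), of Q] that comps' P'_notin by auto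
    then show ?thesis by (auto simp: P'_def)
  qed
  moreover have "set cs \<inter> set P = {}" using distinct_P' by (auto simp: P_def P'_def)
  moreover have "verts D = set P \<union> (\<Union>Q\<in>R. set Q)" by (simp add: verts_def comps P_def)
  ultimately show ?thesis by blast
qed

text \<open>Every edge of the new path ends in an inserted vertex because \<open>cs\<close> is
  nonempty, and no inserted vertex belongs to \<open>D\<close>.\<close>

lemma new_fresh: "new \<inter> edges D = {}"
proof -
  have False if "e \<in> new" "e \<in> edges D" for e
  proof -
    obtain c cs' where c: "cs = c # cs'" using cs by (cases cs) auto
    \<comment> \<open>The first edge is reversed so that its inserted vertex is named first, as in
      \<open>path_edges_inner_endpoint\<close>.\<close>
    then have "e = closed_segment c a \<or> e \<in> path_edges (c # cs' @ [b])"
      using that(1) unfolding new_def unfolding c by (simp add: closed_segment_commute)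
    then have "\<exists>u\<in>set cs. \<exists>v. e = closed_segment u v"
      unfolding c using path_edges_inner_endpoint[of e c cs' b] by auto
    then show False using cs_fresh that(2) edges_endpoint_in_verts by blast
  qed
  then show ?thesis by blast
qed

lemma crossing_kept: "e \<in> kept R \<Longrightarrow> f \<in> kept R \<Longrightarrow> crossing D' e f \<longleftrightarrow> crossing D e f"
  by (rule crossing_cong[OF D' D]) (auto simp: edges_D edges_D')

lemma over_kept: "e \<in> kept R \<Longrightarrow> f \<in> kept R \<Longrightarrow> (e, f) \<in> over D' \<longleftrightarrow> (e, f) \<in> over D"
  using over unfolding kept_eq by blast

lemma classical_crossing_kept:
  "e \<in> kept R \<Longrightarrow> f \<in> kept R \<Longrightarrow> classical_crossing D' e f \<longleftrightarrow> classical_crossing D e f"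
  by (simp add: classical_crossing_def crossing_kept over_kept)

lemma a_b_verts: "a \<in> verts D" "b \<in> verts D" "a \<in> verts D'" "b \<in> verts D'"
  by (simp_all add: verts_def comps comps')

lemma sublink_avoiding: "S \<subseteq> R \<Longrightarrow> sublink D' S = sublink D S"
proof -
  assume "S \<subseteq> R"
  then have "(\<Union>Q\<in>S. poly_edges Q) \<subseteq> kept R" by (auto simp: kept_def)
  then have "over D' \<inter> (\<Union>Q\<in>S. poly_edges Q) \<times> (\<Union>Q\<in>S. poly_edges Q)
      = over D \<inter> (\<Union>Q\<in>S. poly_edges Q) \<times> (\<Union>Q\<in>S. poly_edges Q)"
    using over_kept by blast
  then show ?thesis by (simp add: sublink_def Let_def)
qed

text \<open>Isolates the geometric input about a move. Only edges in \<open>kept R\<close> are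
  tested, so crossings of the new path with itself do not enter.\<close>

definition parity_preserving where
  "parity_preserving \<longleftrightarrow>
    (\<forall>f\<in>kept R. odd (card {e \<in> new. classical_crossing D' e f}) \<longleftrightarrow> classical_crossing D old f)"

text \<open>For each \<open>f\<close> in \<open>B\<close>, crossings with \<open>A\<close> are the
  same in both diagrams, and those with the path agree modulo 2 with those of the old edge.
  Disjointness of \<open>new\<close> and \<open>A\<close>, and \<open>old\<close> lying outside
  \<open>A\<close>, let these contributions be added.\<close>

lemma crossing_number_parity:
  assumes odd: parity_preserving
    and A: "A \<subseteq> kept R" "finite A" and B: "B \<subseteq> kept R" "finite B"
  shows "crossing_number D' (new \<union> A) B mod 2 = crossing_number D (insert old A) B mod 2"
proof -
  let ?n = "\<lambda>f. card {e \<in> new \<union> A. classical_crossing D' e f}"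
    and ?m = "\<lambda>f. card {e \<in> insert old A. classical_crossing D e f}"
  have fin: "finite new" by (simp add: new_def finite_path_edges)
  have "?n f mod 2 = ?m f mod 2" if f: "f \<in> B" for f
  proof -
    have kept: "{e \<in> A. classical_crossing D' e f} = {e \<in> A. classical_crossing D e f}"
      using classical_crossing_kept A B f by blast
    have "{e \<in> new \<union> A. classical_crossing D' e f}
        = {e \<in> new. classical_crossing D' e f} \<union> {e \<in> A. classical_crossing D e f}"
      using kept by blast
    moreover have "new \<inter> A = {}" using new_fresh A edges_D by blast
    ultimately have n: "?n f = card {e \<in> new. classical_crossing D' e f}
        + card {e \<in> A. classical_crossing D e f}"
      using fin A by (simp only:) (rule card_Un_disjoint, auto)
    have "{e \<in> insert old A. classical_crossing D e f}
        = (if classical_crossing D old f then {old} else {}) \<union> {e \<in> A. classical_crossing D e f}"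
      by auto
    moreover have "old \<notin> A" using old_notin_kept A by blast
    ultimately have m: "?m f = of_bool (classical_crossing D old f)
        + card {e \<in> A. classical_crossing D e f}"
      using A by auto
    have "odd (card {e \<in> new. classical_crossing D' e f}) \<longleftrightarrow> classical_crossing D old f"
      using odd B f by (auto simp: parity_preserving_def)
    then have "odd (?n f) \<longleftrightarrow> odd (?m f)" unfolding n m by auto
    then show ?thesis by (simp add: mod2_eq_if)
  qed
  then have "(\<Sum>f\<in>B. ?n f mod 2) mod 2 = (\<Sum>f\<in>B. ?m f mod 2) mod 2" by simp
  then show ?thesis using fin A B by (simp add: crossing_number_sum mod_sum_eq)
qed

lemma finite_kept: "S \<subseteq> R \<Longrightarrow> finite (kept S)"
proof -
  assume "S \<subseteq> R"
  moreover have "finite R" using D comps by (simp add: is_vdiagram_def)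
  ultimately have "finite S" by (rule finite_subset)
  then show ?thesis by (simp add: kept_def finite_path_edges finite_poly_edges)
qed

text \<open>Sub-links without the changed component are identical. In the others, the changed edge
  lies either on the component whose parity is taken or among the remaining components; symmetry of
  the crossing number reduces both cases to \<open>crossing_number_parity\<close>.\<close>

lemma link_iso_replace:
  assumes odd: parity_preserving
    and vm: "\<And>S. S \<subseteq> R \<Longrightarrow> vmove ori (sublink D (insert P S)) (sublink D' (insert P' S))"
  shows "link_iso ori (replace P P') D D'"
  unfolding link_iso_def
proof (intro conjI allI impI)
  let ?\<phi> = "replace P P'"
  have P: "P \<notin> R" using P_notin by (simp add: P_def)
  show "bij_betw ?\<phi> (comps D) (comps D')"
    using bij_betw_replace[OF P P'_notin] by (simp add: comps comps' P_def P'_def)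
  fix S assume S: "S \<subseteq> comps D"
  have "same_link ori (sublink D S) (sublink D' (?\<phi> ` S)) \<and>
      (\<forall>Q\<in>S. parity (sublink D S) Q = parity (sublink D' (?\<phi> ` S)) (?\<phi> Q))"
  proof (cases "P \<in> S")
    case False
    then have "S \<subseteq> R" using S by (auto simp: comps P_def)
    then have "sublink D' (?\<phi> ` S) = sublink D S"
      using False by (simp add: replace_image sublink_avoiding)
    moreover have "?\<phi> Q = Q" if "Q \<in> S" for Q using False that by (auto simp: replace_def)
    ultimately show ?thesis by (simp add: same_link_refl)
  next
    case True
    define T where "T = S - {P}"
    have T: "S = insert P T" "P \<notin> T" "T \<subseteq> R"
      using True S by (auto simp: T_def comps P_def)
    have T': "P' \<notin> T" using T P'_notin by blast
    have \<phi>S: "?\<phi> ` S = insert P' T" unfolding T(1) by (rule replace_image_insert[OF T(2)])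
    have sub: "insert P T \<subseteq> comps D" "insert P' T \<subseteq> comps D'"
      using T by (auto simp: comps comps' P_def P'_def)
    have edges_T: "(\<Union>Q\<in>T. poly_edges Q) \<subseteq> kept R"
      using T by (auto simp: kept_def)
    have finT: "finite (\<Union>Q\<in>T. poly_edges Q)"
      by (rule finite_subset[OF _ finite_kept[OF T(3)]]) (auto simp: kept_def)
    have "parity (sublink D S) Q = parity (sublink D' (?\<phi> ` S)) (?\<phi> Q)" if "Q \<in> S" for Q
    proof (cases "Q = P")
      case True
      \<comment> \<open>Parity of the changed component: the path and the rest of its polygon
        against all other components.\<close>
      have "crossing_number D' (new \<union> kept {}) (\<Union>Q\<in>T. poly_edges Q) mod 2
          = crossing_number D (insert old (kept {})) (\<Union>Q\<in>T. poly_edges Q) mod 2"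
        by (rule crossing_number_parity[OF odd])
          (simp_all add: kept_mono finite_kept edges_T finT)
      moreover have "?\<phi> Q = P'" using True by (simp add: replace_def)
      moreover have "insert P T - {P} = T" "insert P' T - {P'} = T" using T T' by auto
      ultimately show ?thesis
        unfolding \<phi>S unfolding T(1)
        using sub by (simp add: True parity_sublink D D' poly_edges_P poly_edges_P')
    next
      case False
      then have Q: "Q \<in> T" "Q \<noteq> P'" "?\<phi> Q = Q" using that T T' by (auto simp: replace_def)
      \<comment> \<open>For an unchanged component \<open>Q\<close> the path is on the opposing
        side, so \<open>?A\<close> collects the unchanged edges of all components except
        \<open>Q\<close>.\<close>
      let ?A = "kept (T - {Q})"
      have "crossing_number D' (new \<union> ?A) (poly_edges Q) mod 2
          = crossing_number D (insert old ?A) (poly_edges Q) mod 2"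
      proof (rule crossing_number_parity[OF odd])
        show "?A \<subseteq> kept R" using T by (intro kept_mono) blast
        show "finite ?A" using T by (intro finite_kept) blast
        show "poly_edges Q \<subseteq> kept R" using edges_T Q by blast
      qed (rule finite_poly_edges)
      moreover have "insert P T - {Q} = insert P (T - {Q})" "insert P' T - {Q} = insert P' (T - {Q})"
        using Q False by auto
      ultimately have "crossing_number D' (poly_edges Q) (\<Union>Q\<in>insert P' T - {Q}. poly_edges Q) mod 2
          = crossing_number D (poly_edges Q) (\<Union>Q\<in>insert P T - {Q}. poly_edges Q) mod 2"
        by (simp only: edges_insert_P edges_insert_P' crossing_number_commute[of _ "poly_edges Q"])
      then show ?thesis
        unfolding \<phi>S Q(3) unfolding T(1)
        using parity_sublink[OF D sub(1)] parity_sublink[OF D' sub(2)] Q by simp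
    qed
    moreover have "same_link ori (sublink D S) (sublink D' (?\<phi> ` S))"
      unfolding \<phi>S unfolding T(1) using vm[OF T(3)] by (auto simp: same_link_def)
    ultimately show ?thesis by blast
  qed
  then show "same_link ori (sublink D S) (sublink D' (?\<phi> ` S))"
    "\<forall>Q\<in>S. parity (sublink D S) Q = parity (sublink D' (?\<phi> ` S)) (?\<phi> Q)" by blast+
qed

lemma insert_subset_comps:
  assumes "S \<subseteq> R"
  shows "insert P S \<subseteq> comps D" "insert P' S \<subseteq> comps D'"
  using assms by (auto simp: comps comps' P_def P'_def)

lemma edges_sublink_insert:
  "edges (sublink D (insert P S)) = insert old (kept S)"
  "edges (sublink D' (insert P' S)) = new \<union> kept S"
  by (simp_all only: edges_sublink edges_insert_P edges_insert_P')

text \<open>Restricting to a sub-link that contains the changed component gives another instance of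
  the locale, with \<open>S\<close> in place of \<open>R\<close>.\<close>

lemma edge_replacement_sublink:
  assumes S: "S \<subseteq> R"
  shows "edge_replacement (sublink D (insert P S)) (sublink D' (insert P' S)) a cs b xs S"
proof
  show "is_vdiagram (sublink D (insert P S))" "is_vdiagram (sublink D' (insert P' S))"
    by (rule is_vdiagram_sublink, rule D D', rule insert_subset_comps[OF S])+
  show "cs \<noteq> []" by (rule cs)
  show "a # b # xs \<notin> S" using S P_notin by blast
  show "comps (sublink D (insert P S)) = insert (a # b # xs) S"
    "comps (sublink D' (insert P' S)) = insert (a # cs @ b # xs) S"
    by (simp_all add: P_def P'_def)
  have "edges (sublink D (insert P S)) - {closed_segment a b} = kept S"
    using old_notin_kept kept_mono[OF S] by (auto simp: edges_sublink_insert old_def)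
  moreover have "(e, f) \<in> over (sublink D (insert P S)) \<longleftrightarrow> (e, f) \<in> over (sublink D' (insert P' S))"
    if "e \<in> kept S" "f \<in> kept S" for e f
    using that over_kept[of e f] kept_mono[OF S] by (auto simp: over_sublink edges_sublink_insert)
  ultimately show "over (sublink D (insert P S)) \<inter>
      (edges (sublink D (insert P S)) - {closed_segment a b}) \<times>
      (edges (sublink D (insert P S)) - {closed_segment a b}) =
    over (sublink D' (insert P' S)) \<inter>
      (edges (sublink D (insert P S)) - {closed_segment a b}) \<times>
      (edges (sublink D (insert P S)) - {closed_segment a b})"
    by auto
qed

lemmas replaces_edge_sublink = edge_replacement.replaces_edge[OF edge_replacement_sublink]

lemma crossing_sublink_insert:
  assumes "S \<subseteq> R"
  shows "crossing (sublink D (insert P S)) e f \<longleftrightarrow>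
      crossing D e f \<and> e \<in> insert old (kept S) \<and> f \<in> insert old (kept S)"
    "crossing (sublink D' (insert P' S)) e f \<longleftrightarrow>
      crossing D' e f \<and> e \<in> new \<union> kept S \<and> f \<in> new \<union> kept S"
  using crossing_sublink[OF D insert_subset_comps(1)[OF assms]]
    crossing_sublink[OF D' insert_subset_comps(2)[OF assms]]
  by (simp_all only: edges_sublink_insert)

lemma over_sublink_insert:
  "(e, f) \<in> over (sublink D (insert P S)) \<longleftrightarrow>
    (e, f) \<in> over D \<and> e \<in> insert old (kept S) \<and> f \<in> insert old (kept S)"
  "(e, f) \<in> over (sublink D' (insert P' S)) \<longleftrightarrow>
    (e, f) \<in> over D' \<and> e \<in> new \<union> kept S \<and> f \<in> new \<union> kept S"
  by (simp_all only: over_sublink edges_sublink_insert)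

text \<open>All three strands survive, and their crossings and over/under data are inherited, so the
  same arrangement \<open>x\<close>, \<open>y\<close>, \<open>z\<close> works.\<close>

lemma r3_admissible_sublink:
  assumes S: "S \<subseteq> R" and fg: "f \<in> kept S" "g \<in> kept S" and r3: "r3_admissible D old f g"
  shows "r3_admissible (sublink D (insert P S)) old f g"
proof -
  obtain x y z where xyz: "{x, y, z} = {old, f, g}"
    and c: "virtual_crossing D x y \<and> virtual_crossing D x z \<and> crossing D y z \<or>
         (x, y) \<in> over D \<and> (x, z) \<in> over D \<and> (y, z) \<in> over D"
    using r3 unfolding r3_admissible_def by blast
  have "{x, y, z} \<subseteq> insert old (kept S)" unfolding xyz using fg by blast
  then have "virtual_crossing (sublink D (insert P S)) x y \<and>
      virtual_crossing (sublink D (insert P S)) x z \<and> crossing (sublink D (insert P S)) y z \<or>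
      (x, y) \<in> over (sublink D (insert P S)) \<and> (x, z) \<in> over (sublink D (insert P S)) \<and>
      (y, z) \<in> over (sublink D (insert P S))"
    using c unfolding virtual_crossing_def crossing_sublink_insert[OF S] over_sublink_insert
    by blast
  then show ?thesis unfolding r3_admissible_def using xyz by blast
qed

text \<open>The old edge and all new edges lie in the convex hull, so \<open>f\<close> can meet them
  only at \<open>a\<close> or \<open>b\<close>. These are vertices, where no crossing
  occurs.\<close>

lemma not_crossing_if_avoids:
  assumes "avoids f a b cs"
  shows "\<not> crossing D old f" "e \<in> new \<Longrightarrow> \<not> crossing D' e f"
proof -
  let ?H = "convex hull ({a, b} \<union> set cs)"
  have f: "f \<inter> ?H \<subseteq> {a, b}" using assms by (simp add: avoids_def)
  have seg: "closed_segment u v \<subseteq> ?H" if "u \<in> {a, b} \<union> set cs" "v \<in> {a, b} \<union> set cs" for u v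
    using that by (intro closed_segment_subset hull_inc) auto
  have "old \<subseteq> ?H" unfolding old_def by (rule seg) auto
  then show "\<not> crossing D old f" using f a_b_verts unfolding crossing_def by blast
  show "\<not> crossing D' e f" if "e \<in> new"
  proof -
    have "{a, b} \<union> set cs = set (a # cs @ [b])" by auto
    then obtain u v where "u \<in> {a, b} \<union> set cs" "v \<in> {a, b} \<union> set cs" "e = closed_segment u v"
      using path_edges_endpoints[of e "a # cs @ [b]"] \<open>e \<in> new\<close> unfolding new_def by blast
    then have "e \<subseteq> ?H" using seg by simp
    then show ?thesis using f a_b_verts unfolding crossing_def by blast
  qed
qed

lemma odd_classical_avoids:
  assumes "avoids f a b cs"
  shows "odd (card {e \<in> new. classical_crossing D' e f}) \<longleftrightarrow> classical_crossing D old f"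
  using not_crossing_if_avoids[OF assms] by (simp add: classical_crossing_def cong: conj_cong)

end

section \<open>Moves inserting one vertex: isotopy, second and third Reidemeister moves\<close>

locale triangle_replacement = edge_replacement D D' a "[c]" b xs R for D D' a c b xs R
begin

lemma new_eq: "new = {closed_segment a c, closed_segment c b}"
  by (simp add: new_def)

lemma new_neq: "closed_segment a c \<noteq> closed_segment c b"
  using distinct_P' by (auto simp: P'_def doubleton_eq_iff)

lemma not_passes_through_if_avoids: "avoids f a b [c] \<Longrightarrow> \<not> passes_through D D' a c b f"
  using not_crossing_if_avoids(1) by (auto simp: passes_through_def old_def)

lemma passes_through_sublink:
  assumes S: "S \<subseteq> R"
  shows "passes_through (sublink D (insert P S)) (sublink D' (insert P' S)) a c b f \<longleftrightarrow>
    passes_through D D' a c b f \<and> f \<in> kept S"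
proof (cases "f \<in> kept S")
  case True
  then show ?thesis
    unfolding passes_through_def same_type_def crossing_sublink_insert[OF S] over_sublink_insert
    by (simp add: new_eq old_def[symmetric])
next
  case False
  \<comment> \<open>A crossing involves two distinct edges, so a strand crossing \<open>old\<close>
    in the sub-link must belong to \<open>kept S\<close>.\<close>
  have "f \<noteq> old" if "crossing D old f" using that by (auto simp: crossing_def)
  then show ?thesis
    using False unfolding passes_through_def crossing_sublink_insert[OF S] old_def[symmetric]
    by blast
qed

text \<open>Exactly one of the two new sides crosses \<open>f\<close>, and with the type of the old
  crossing: the count is 1 if that crossing was classical and 0 if it was virtual.\<close>

lemma odd_classical_passes_through:
  assumes "passes_through D D' a c b f"
  shows "odd (card {e \<in> new. classical_crossing D' e f}) \<longleftrightarrow> classical_crossing D old f"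
proof -
  have ab: "crossing D old f"
    and one: "crossing D' (closed_segment a c) f \<noteq> crossing D' (closed_segment c b) f"
    and same: "\<And>e. e \<in> new \<Longrightarrow> crossing D' e f \<Longrightarrow> same_type D old f D' e f"
    using assms by (auto simp: passes_through_def old_def new_eq)
  have cc: "classical_crossing D' e f \<longleftrightarrow> classical_crossing D old f"
    if "e \<in> new" "crossing D' e f" for e
    using same[OF that] ab that by (auto simp: classical_crossing_def same_type_def)
  obtain e where e: "{e' \<in> new. crossing D' e' f} = {e}"
  proof (cases "crossing D' (closed_segment a c) f")
    case True
    then show ?thesis using one by (intro that[of "closed_segment a c"]) (auto simp: new_eq)
  next
    case False
    then show ?thesis using one by (intro that[of "closed_segment c b"]) (auto simp: new_eq)
  qed
  have "{e' \<in> new. classical_crossing D' e' f}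
      = {e' \<in> {e' \<in> new. crossing D' e' f}. classical_crossing D' e' f}"
    by (auto simp: classical_crossing_def)
  also have "\<dots> = (if classical_crossing D old f then {e} else {})"
  proof -
    have "e \<in> new" "crossing D' e f" using e by blast+
    then show ?thesis unfolding e using cc by auto
  qed
  finally show ?thesis by simp
qed

lemma parity_preserving_if_avoids_or_passes:
  assumes "\<forall>f\<in>kept R. avoids f a b [c] \<or> passes_through D D' a c b f"
  shows parity_preserving
  unfolding parity_preserving_def
  using assms odd_classical_avoids odd_classical_passes_through by blast

text \<open>The hypotheses concern only strands surviving in \<open>S\<close>. The lemma therefore
  also applies when the move on the full diagram is not an isotopy.\<close>

lemma isotopy_sublink:
  assumes S: "S \<subseteq> R"
    and f: "\<And>f. f \<in> kept S \<Longrightarrow> avoids f a b [c] \<or> passes_through D D' a c b f"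
    and fg: "\<And>f g. f \<in> kept S \<Longrightarrow> g \<in> kept S \<Longrightarrow> passes_through D D' a c b f \<Longrightarrow>
      passes_through D D' a c b g \<Longrightarrow> f \<noteq> g \<Longrightarrow> f \<inter> g \<inter> convex hull {a, b, c} = {}"
  shows "vmove ori (sublink D (insert P S)) (sublink D' (insert P' S))"
proof (rule vmove.isotopy[OF replaces_edge_sublink[OF S]])
  show "\<forall>f\<in>edges (sublink D (insert P S)) - {closed_segment a b}. avoids f a b [c] \<or>
      passes_through (sublink D (insert P S)) (sublink D' (insert P' S)) a c b f"
    using f by (auto simp: edges_sublink_insert passes_through_sublink[OF S] old_def)
  show "\<forall>f g. passes_through (sublink D (insert P S)) (sublink D' (insert P' S)) a c b f \<and>
      passes_through (sublink D (insert P S)) (sublink D' (insert P' S)) a c b g \<and> f \<noteq> g \<longrightarrow>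
      f \<inter> g \<inter> convex hull {a, b, c} = {}"
    using fg by (simp add: passes_through_sublink[OF S])
qed

lemma isotopy_link_iso:
  assumes f: "\<forall>f\<in>edges D - {closed_segment a b}. avoids f a b [c] \<or> passes_through D D' a c b f"
    and fg: "\<forall>f g. passes_through D D' a c b f \<and> passes_through D D' a c b g \<and> f \<noteq> g
        \<longrightarrow> f \<inter> g \<inter> convex hull {a, b, c} = {}"
  shows "link_iso ori (replace P P') D D'"
proof (rule link_iso_replace)
  show parity_preserving
    using f by (intro parity_preserving_if_avoids_or_passes) (simp add: kept_eq)
  fix S assume S: "S \<subseteq> R"
  show "vmove ori (sublink D (insert P S)) (sublink D' (insert P' S))"
    using f fg kept_mono[OF S] by (intro isotopy_sublink[OF S]) (auto simp: kept_eq)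
qed

text \<open>When the strand \<open>f\<close> is deleted, a second Reidemeister move degenerates to an isotopy;
  likewise a third one when one of the strands \<open>f\<close>, \<open>g\<close> is deleted.\<close>

lemma R2_link_iso:
  assumes f: "f \<in> edges D" "f \<inter> closed_segment a b = {}"
    and cr: "crossing D' (closed_segment a c) f" "crossing D' (closed_segment c b) f"
    and same: "same_type D' (closed_segment a c) f D' (closed_segment c b) f"
    and avoid: "\<forall>g\<in>edges D - {closed_segment a b, f}. avoids g a b [c]"
  shows "link_iso ori (replace P P') D D'"
proof (rule link_iso_replace)
  have "old \<noteq> f" using f(2) by (auto simp: old_def)
  then have fk: "f \<in> kept R" using f(1) by (simp add: kept_eq old_def)
  have avoid': "avoids g a b [c]" if "g \<in> kept R" "g \<noteq> f" for g
    using avoid that by (simp add: kept_eq)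
  have "odd (card {e \<in> new. classical_crossing D' e f}) \<longleftrightarrow> classical_crossing D old f"
  proof -
    \<comment> \<open>The two crossings with \<open>f\<close> have the same type, so they contribute
      2 or 0, while the old edge misses \<open>f\<close> altogether.\<close>
    have "{e \<in> new. classical_crossing D' e f} = (if classical_crossing D' (closed_segment a c) f
        then {closed_segment a c, closed_segment c b} else {})"
      using cr same by (auto simp: new_eq classical_crossing_def same_type_def)
    moreover have "\<not> classical_crossing D old f"
      using f(2) by (auto simp: classical_crossing_def crossing_def old_def)
    ultimately show ?thesis using new_neq by simp
  qed
  then show parity_preserving
    unfolding parity_preserving_def using avoid' odd_classical_avoids by blast
  fix S assume S: "S \<subseteq> R"
  show "vmove ori (sublink D (insert P S)) (sublink D' (insert P' S))"
  proof (cases "f \<in> kept S")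
    case True
    show ?thesis
    proof (rule vmove.R2[OF replaces_edge_sublink[OF S]])
      show "f \<in> edges (sublink D (insert P S))" using True by (simp add: edges_sublink_insert)
      show "f \<inter> closed_segment a b = {}" by (rule f(2))
      show "crossing (sublink D' (insert P' S)) (closed_segment a c) f"
        "crossing (sublink D' (insert P' S)) (closed_segment c b) f"
        using True cr by (simp_all add: crossing_sublink_insert[OF S] new_eq)
      show "same_type (sublink D' (insert P' S)) (closed_segment a c) f
          (sublink D' (insert P' S)) (closed_segment c b) f"
        using True same by (simp add: same_type_def over_sublink_insert new_eq)
      show "\<forall>g\<in>edges (sublink D (insert P S)) - {closed_segment a b, f}. avoids g a b [c]"
        using avoid' kept_mono[OF S] by (auto simp: edges_sublink_insert old_def)
    qed
  next
    case False
    then have "avoids g a b [c]" if "g \<in> kept S" for g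
      using avoid' kept_mono[OF S] that by blast
    then show ?thesis
      using not_passes_through_if_avoids by (intro isotopy_sublink[OF S]) auto
  qed
qed

lemma R3_link_iso:
  assumes f: "passes_through D D' a c b f" and g: "passes_through D D' a c b g" and fg: "f \<noteq> g"
    and meet: "f \<inter> g \<inter> convex hull {a, b, c} \<noteq> {}"
    and r3: "r3_admissible D (closed_segment a b) f g"
    and avoid: "\<forall>h\<in>edges D - {closed_segment a b, f, g}. avoids h a b [c]"
  shows "link_iso ori (replace P P') D D'"
proof (rule link_iso_replace)
  have avoid': "avoids h a b [c]" if "h \<in> kept R" "h \<noteq> f" "h \<noteq> g" for h
    using avoid that by (simp add: kept_eq)
  have any: "avoids h a b [c] \<or> passes_through D D' a c b h" if "h \<in> kept R" for h
    using avoid' f g that by blast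
  then show parity_preserving
    by (intro parity_preserving_if_avoids_or_passes) blast
  fix S assume S: "S \<subseteq> R"
  show "vmove ori (sublink D (insert P S)) (sublink D' (insert P' S))"
  proof (cases "f \<in> kept S \<and> g \<in> kept S")
    case True
    show ?thesis
    proof (rule vmove.R3[OF replaces_edge_sublink[OF S] _ _ fg meet])
      show "passes_through (sublink D (insert P S)) (sublink D' (insert P' S)) a c b f"
        "passes_through (sublink D (insert P S)) (sublink D' (insert P' S)) a c b g"
        using True f g by (simp_all add: passes_through_sublink[OF S])
      show "r3_admissible (sublink D (insert P S)) (closed_segment a b) f g"
        using True r3 r3_admissible_sublink[OF S] by (simp add: old_def)
      show "\<forall>h\<in>edges (sublink D (insert P S)) - {closed_segment a b, f, g}. avoids h a b [c]"
        using avoid' kept_mono[OF S] by (auto simp: edges_sublink_insert old_def)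
    qed
  next
    case False
    show ?thesis
    proof (rule isotopy_sublink[OF S])
      show "avoids h a b [c] \<or> passes_through D D' a c b h" if "h \<in> kept S" for h
        using any kept_mono[OF S] that by blast
      fix h k
      assume hk: "h \<in> kept S" "k \<in> kept S" "passes_through D D' a c b h"
        "passes_through D D' a c b k" "h \<noteq> k"
      \<comment> \<open>Only \<open>f\<close> and \<open>g\<close> can pass through the triangle.
        Two distinct passing strands would be exactly these, contradicting the deletion of one of
        them.\<close>
      then have "h = f \<or> h = g" "k = f \<or> k = g"
        using avoid' kept_mono[OF S] not_passes_through_if_avoids by blast+
      then show "h \<inter> k \<inter> convex hull {a, b, c} = {}" using False hk by blast
    qed
  qed
qed

end

text \<open>The created crossing lies between two edges of the new path, hence within one component.
  All other edges avoid the hull, so every count in \<open>parity_preserving\<close> is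
  zero.\<close>

lemma (in edge_replacement) R1_link_iso:
  assumes cs_eq: "cs = [c, d]"
    and avoid: "\<forall>f\<in>edges D - {closed_segment a b}. avoids f a b cs"
    and cr: "crossing D' (closed_segment a c) (closed_segment d b)"
  shows "link_iso ori (replace P P') D D'"
proof (rule link_iso_replace)
  show parity_preserving
    unfolding parity_preserving_def using avoid odd_classical_avoids by (simp add: kept_eq)
  fix S assume S: "S \<subseteq> R"
  show "vmove ori (sublink D (insert P S)) (sublink D' (insert P' S))"
  proof (rule vmove.R1)
    show "replaces_edge (sublink D (insert P S)) (sublink D' (insert P' S)) a [c, d] b"
      using replaces_edge_sublink[OF S] by (simp add: cs_eq)
    show "\<forall>f\<in>edges (sublink D (insert P S)) - {closed_segment a b}. avoids f a b [c, d]"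
      using avoid edges_sublink_subset[OF insert_subset_comps(1)[OF S]]
      unfolding cs_eq by blast
    have "closed_segment a c \<in> new" "closed_segment d b \<in> new"
      unfolding new_def unfolding cs_eq by simp_all
    then show "crossing (sublink D' (insert P' S)) (closed_segment a c) (closed_segment d b)"
      using cr by (simp add: crossing_sublink_insert[OF S])
  qed
qed

lemma replaces_triangleE:
  assumes "replaces_edge D D' a [c] b"
  obtains xs R where "triangle_replacement D D' a c b xs R"
  using replaces_edgeE[OF assms] unfolding triangle_replacement_def by blast

section \<open>From single moves to equivalent diagrams\<close>

lemma vmove_link_iso:
  assumes "vmove ori D D'"
  shows "\<exists>\<phi>. link_iso ori \<phi> D D'"
  using assms
proof cases
  case (restart P R)
  have "link_iso ori (replace P (rotate1 P)) D (D\<lparr>comps := insert (rotate1 P) R\<rparr>)"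
  proof (rule link_iso_relabel[OF restart(2-4)])
    fix S assume S: "S \<subseteq> R"
    show "vmove ori (sublink D (insert P S)) (sublink D (insert P S)\<lparr>comps := insert (rotate1 P) S\<rparr>)"
      using S restart(3,4)
      by (intro vmove.restart is_vdiagram_sublink restart(2)) auto
  qed (simp_all add: poly_edges_rotate1)
  then show ?thesis unfolding restart(1) by blast
next
  case (reverse P R)
  have "link_iso ori (replace P (rev P)) D (D\<lparr>comps := insert (rev P) R\<rparr>)"
  proof (rule link_iso_relabel[OF reverse(3-5)])
    fix S assume S: "S \<subseteq> R"
    show "vmove ori (sublink D (insert P S)) (sublink D (insert P S)\<lparr>comps := insert (rev P) S\<rparr>)"
      using S reverse(4,5)
      by (intro vmove.reverse is_vdiagram_sublink reverse(2,3)) auto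
  qed (simp_all add: poly_edges_rev)
  then show ?thesis unfolding reverse(1) by blast
next
  case (isotopy a c b)
  obtain xs R where "triangle_replacement D D' a c b xs R"
    by (rule replaces_triangleE[OF isotopy(1)])
  from triangle_replacement.isotopy_link_iso[OF this isotopy(2,3)] show ?thesis by blast
next
  case (R1 a c d b)
  obtain xs R where "edge_replacement D D' a [c, d] b xs R"
    by (rule replaces_edgeE[OF R1(1)]) simp_all
  from edge_replacement.R1_link_iso[OF this refl R1(2,3)] show ?thesis by blast
next
  case (R2 a c b f)
  obtain xs R where "triangle_replacement D D' a c b xs R"
    by (rule replaces_triangleE[OF R2(1)])
  from triangle_replacement.R2_link_iso[OF this R2(2-7)] show ?thesis by blast
next
  case (R3 a c b f g)
  obtain xs R where "triangle_replacement D D' a c b xs R"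
    by (rule replaces_triangleE[OF R3(1)])
  from triangle_replacement.R3_link_iso[OF this R3(2-7)] show ?thesis by blast
qed

lemma same_link_link_iso:
  assumes "same_link ori D D'"
  shows "\<exists>\<phi>. link_iso ori \<phi> D D'"
  using assms unfolding same_link_def
proof (induction rule: equivclp_induct)
  case base
  show ?case using link_iso_refl by blast
next
  case (step D' D'')
  \<comment> \<open>The chain may traverse a move in either direction; a backward move uses the
    inverse bijection.\<close>
  then have "\<exists>\<psi>. link_iso ori \<psi> D' D''" using vmove_link_iso link_iso_sym by blast
  then show ?case using step link_iso_trans by blast
qed

theorem theorem2:
  fixes ori :: orientation and \<Psi> :: "vdiagram \<Rightarrow> 'a"
  assumes "even_link_invariant ori \<Psi>"
  shows "(\<forall>D. is_vdiagram D \<longrightarrow> (\<forall>C\<in>set (multi_core D). is_vdiagram C \<and> even_link C)) \<and>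
         link_invariant ori (\<lambda>D. map \<Psi> (multi_core D))"
proof
  have core: "is_vdiagram C \<and> even_link C" if "is_vdiagram D" "C \<in> set (multi_core D)" for D C
    using that
    by (auto simp: multi_core_def is_vdiagram_core even_link_core is_vdiagram_mantle_pow)
  then show "\<forall>D. is_vdiagram D \<longrightarrow> (\<forall>C\<in>set (multi_core D). is_vdiagram C \<and> even_link C)"
    by blast
  show "link_invariant ori (\<lambda>D. map \<Psi> (multi_core D))"
    unfolding link_invariant_def
  proof (intro allI impI, elim conjE)
    fix D D' assume D: "is_vdiagram D" "is_vdiagram D'" and "same_link ori D D'"
    then obtain \<phi> where "link_iso ori \<phi> D D'" using same_link_link_iso by blast
    then have "list_all2 (same_link ori) (multi_core D) (multi_core D')"
      using D by (rule link_iso_multi_core)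
    \<comment> \<open>Corresponding cores are even diagrams of the same link, so
      \<open>\<Psi>\<close> may be compared on them entry by entry.\<close>
    then have "list_all2 (\<lambda>C C'. \<Psi> C = \<Psi> C') (multi_core D) (multi_core D')"
      by (rule list.rel_mono_strong)
        (use assms core D in \<open>auto simp: even_link_invariant_def\<close>)
    then show "map \<Psi> (multi_core D) = map \<Psi> (multi_core D')"
      by (simp add: list_all2_conv_all_nth list_eq_iff_nth_eq)
  qed
qed

end
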